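(* Let $a_1,a_2,b,z\in\mathbb{C}$ with $|z|<1$ and $b\neq-1,-2,\ldots$. Let $\{P_n\}_{n\ge0}$ be the Generalized Hahn polynomials of type I, i.e. the monic orthogonal polynomials (assumed to exist) with respect to the linear functional $$L[f]=\sum_{x=0}^{\infty}f(x)\rho(x),\qquad \rho(x)=\frac{(a_1)_x(a_2)_x}{(b+1)_x}\frac{z^x}{x!},$$ and let $\beta_n,\gamma_n$ be their recurrence coefficients, $$xP_n(x)=P_{n+1}(x)+\beta_nP_n(x)+\gamma_nP_{n-1}(x),\qquad n\ge0,\quad \gamma_0=0.$$ Set $$u_n=\beta_n+\beta_{n-1}-n+b+1,\qquad v_n=\beta_n+\beta_{n-1}+n-1+a_1+a_2.$$ Then for all $n\ge1$ the Laguerre–Freud equations $$(1-z)\nabla_n(\gamma_{n+1}+\gamma_n)=z\,v_n\nabla_n(\beta_n+n)-u_n\nabla_n(\beta_n-n),$$ $$\Delta_n\nabla_n\left[(u_n-zv_n)\gamma_n\right]=u_n\nabla_n(\beta_n-n)+\nabla_n(\gamma_{n+1}+\gamma_n)$$ hold, with initial conditions $\beta_0=\mu_1/\mu_0$ and $$\gamma_1=\frac{(a_1+a_2-b)\beta_0+a_1a_2}{1-z}-(\beta_0+a_1)(\beta_0+a_2),$$ where $$\mu_0={}_2F_1\left[\begin{array}{c}a_1,\ a_2\\ b+1\end{array};z\right],\qquad \mu_1=z\frac{a_1a_2}{b+1}\,{}_2F_1\left[\begin{array}{c}a_1+1,\ a_2+1\\ b+2\end{array};z\right].$$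
   Context: $(a)_x$ denotes the Pochhammer symbol: $(a)_0=1$, $(a)_x=a(a+1)\cdots(a+x-1)$ for $x\in\mathbb{N}$. A sequence of monic polynomials $P_n$ with $\deg P_n=n$, $n\ge0$, is orthogonal with respect to $L$ if $L[P_nP_m]=h_n\delta_{n,m}$ with $h_n\ne0$ for all $n,m\ge 0$. Then $P_0=1$, $P_{-1}=0$, $\beta_n=L[xP_n^2]/h_n$, and $\gamma_n=h_n/h_{n-1}$ for $n\ge1$. The difference operators in $n$ are $\Delta_nf(n)=f(n+1)-f(n)$ and $\nabla_nf(n)=f(n)-f(n-1)$. ${}_2F_1$ is the Gauss hypergeometric function, and $\mu_k=L[x^k]$. Convention: $\beta_{-1}=0$; it only occurs multiplied by $\gamma_0=0$. *)

theory Defs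
  imports "HOL-Analysis.Analysis"
begin

definition hahn_weight :: "complex \<Rightarrow> complex \<Rightarrow> complex \<Rightarrow> complex \<Rightarrow> nat \<Rightarrow> complex" where
  "hahn_weight a1 a2 b z x =
     pochhammer a1 x * pochhammer a2 x / pochhammer (b + 1) x * (z ^ x / fact x)"

definition hahn_functional ::
  "complex \<Rightarrow> complex \<Rightarrow> complex \<Rightarrow> complex \<Rightarrow> complex poly \<Rightarrow> complex" where
  "hahn_functional a1 a2 b z f = (\<Sum>x. poly f (of_nat x) * hahn_weight a1 a2 b z x)"

definition monic_orthogonal :: "(complex poly \<Rightarrow> complex) \<Rightarrow> (nat \<Rightarrow> complex poly) \<Rightarrow> bool" where
  "monic_orthogonal L P \<longleftrightarrow>
     (\<forall>n. degree (P n) = n \<and> lead_coeff (P n) = 1) \<and>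
     (\<exists>h. (\<forall>n. h n \<noteq> 0) \<and> (\<forall>n m. L (P n * P m) = (if n = m then h n else 0)))"

text \<open>Sequences indexed by \<open>nat\<close> are extended by the value \<open>0\<close> at index \<open>-1\<close>;
  this gives the conventions \<open>P\<^sub>-\<^sub>1 = 0\<close> and \<open>\<beta>\<^sub>-\<^sub>1 = 0\<close>.\<close>

definition prev :: "(nat \<Rightarrow> 'a::zero) \<Rightarrow> nat \<Rightarrow> 'a" where
  "prev f n = (if n = 0 then 0 else f (n - 1))"

definition recurrence_coeffs ::
  "(nat \<Rightarrow> complex poly) \<Rightarrow> (nat \<Rightarrow> complex) \<Rightarrow> (nat \<Rightarrow> complex) \<Rightarrow> bool" where
  "recurrence_coeffs P \<beta> \<gamma> \<longleftrightarrow> \<gamma> 0 = 0 \<and>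
     (\<forall>n. [:0, 1:] * P n = P (Suc n) + smult (\<beta> n) (P n) + smult (\<gamma> n) (prev P n))"

definition fwd_diff :: "(nat \<Rightarrow> complex) \<Rightarrow> nat \<Rightarrow> complex" where
  "fwd_diff f n = f (Suc n) - f n"

text \<open>Only the values at \<open>n \<ge> 1\<close> are meaningful, because \<open>prev\<close> puts \<open>0\<close> at index \<open>-1\<close>.\<close>

definition bwd_diff :: "(nat \<Rightarrow> complex) \<Rightarrow> nat \<Rightarrow> complex" where
  "bwd_diff f n = f n - prev f n"

text \<open>The last argument of \<^const>\<open>fps_hypergeo\<close> rescales the variable, hence the \<open>1\<close>.\<close>

definition hyp2F1 :: "complex \<Rightarrow> complex \<Rightarrow> complex \<Rightarrow> complex \<Rightarrow> complex" where
  "hyp2F1 a b c z = eval_fps (fps_hypergeo [a, b] [c] 1) z"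

lemma hyp2F1_series:
  "hyp2F1 a b c z =
     (\<Sum>n. pochhammer a n * pochhammer b n / pochhammer c n * (z ^ n / fact n))"
  by (simp add: hyp2F1_def eval_fps_def mult_ac)

text \<open>For monic orthogonal polynomials, the recurrence coefficients are uniquely determined and
  are given by the usual formulas.\<close>

lemma recurrence_coeffs_formulas:
  assumes add: "\<And>f g. L (f + g) = L f + L g" and smult: "\<And>c f. L (smult c f) = c * L f"
    and P: "monic_orthogonal L P" and rec: "recurrence_coeffs P \<beta> \<gamma>"
  shows "\<beta> n = L ([:0, 1:] * P n ^ 2) / L (P n ^ 2)"
    and "n \<ge> 1 \<Longrightarrow> \<gamma> n = L (P n ^ 2) / L (P (n - 1) ^ 2)"
proof -
  obtain h where h: "\<And>n. h n \<noteq> 0" "\<And>n m. L (P n * P m) = (if n = m then h n else 0)"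
    using P unfolding monic_orthogonal_def by blast
  have r0: "[:0, 1:] * P k = P (Suc k) + smult (\<beta> k) (P k) + smult (\<gamma> k) (prev P k)" for k
    using rec by (simp add: recurrence_coeffs_def)
  have L0: "L 0 = 0" using smult[of 0 0] by simp
  have r: "L ([:0, 1:] * P k * P m) =
      L (P (Suc k) * P m) + \<beta> k * L (P k * P m) + \<gamma> k * L (prev P k * P m)" for k m
    by (simp only: r0 add smult distrib_right mult_smult_left)
  have sq: "L (P k ^ 2) = h k" for k by (simp add: power2_eq_square h)
  have "L ([:0, 1:] * P n * P n) = \<beta> n * h n"
    by (subst r) (auto simp: h prev_def L0)
  then show "\<beta> n = L ([:0, 1:] * P n ^ 2) / L (P n ^ 2)"
    using h(1)[of n] by (simp only: sq) (simp add: power2_eq_square mult.assoc)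
  assume n: "n \<ge> 1"
  then obtain m where m: "n = Suc m" by (cases n) auto
  have "L ([:0, 1:] * P n * P m) = \<gamma> n * h m"
    by (subst r) (auto simp: h prev_def m)
  moreover have "L ([:0, 1:] * P m * P n) = h n"
    by (subst r) (auto simp: h prev_def m L0)
  moreover have "[:0, 1:] * P n * P m = [:0, 1:] * P m * P n" by (simp only: mult_ac)
  ultimately have "\<gamma> n * h m = h n" by metis
  then show "\<gamma> n = L (P n ^ 2) / L (P (n - 1) ^ 2)"
    using h(1)[of m] by (simp add: sq m field_simps)
qed

end

theory Submission
  imports Defs
begin

text \<open>With \<open>\<phi>(x) = z (x + a\<^sub>1) (x + a\<^sub>2)\<close> and \<open>\<psi>(x) = x (x + b)\<close>, the weight satisfies the
  Pearson equation \<open>\<psi>(x + 1) \<rho>(x + 1) = \<phi>(x) \<rho>(x)\<close>, that is \<open>L[\<psi>(x) f(x)] = L[\<phi>(x) f(x + 1)]\<close>.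
  Hence \<open>M\<^sub>n\<^sub>m = L[\<phi>(x) P\<^sub>n(x + 1) P\<^sub>m(x)] = L[\<psi>(x) P\<^sub>n(x) P\<^sub>m(x - 1)]\<close> vanishes for \<open>\<bar>n - m\<bar> > 2\<close>.
  Evaluating \<open>L[\<phi>(x) (x + 1) P\<^sub>n(x + 1) P\<^sub>m(x)]\<close> with the three-term recurrence for \<open>P\<^sub>n\<close> and
  for \<open>P\<^sub>m\<close> gives a linear recursion for \<open>M\<close>. It determines the outer diagonals from \<open>M\<^sub>0\<^sub>m\<close> and
  \<open>M\<^sub>n\<^sub>0\<close>; on the diagonals \<open>0\<close> and \<open>\<plusminus>1\<close> it gives three expressions involving \<open>M\<^sub>n\<^sub>n / h\<^sub>n\<close>, and
  eliminating this quantity leaves the Laguerre-Freud equations.\<close>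

text \<open>\<open>prev\<close> can be replaced by truncated subtraction, because \<open>\<gamma> 0 = 0\<close>.\<close>

lemma recurrence_coeffs_rec:
  assumes "recurrence_coeffs P \<beta> \<gamma>"
  shows "[:0, 1:] * P n = P (Suc n) + smult (\<beta> n) (P n) + smult (\<gamma> n) (P (n - 1))"
  using assms unfolding recurrence_coeffs_def prev_def by (cases n) auto

section \<open>Solving the linear recursion for banded arrays\<close>

text \<open>Read as a rule for row \<open>n + 1\<close>, the recursion carries the data of row
  \<open>0\<close> down the diagonals by induction on \<open>n\<close>. The parameters
  \<open>\<epsilon>\<close>, \<open>c\<close> and \<open>e\<close> are kept free so that the result
  applies both to the array of the proof and to its transpose.\<close>

lemma banded_recursion:
  fixes M :: "nat \<Rightarrow> nat \<Rightarrow> complex" and \<beta> \<gamma> h :: "nat \<Rightarrow> complex" and \<epsilon> c e :: complex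
  assumes rec: "\<And>n m. M (Suc n) m + \<beta> n * M n m + \<gamma> n * M (n - 1) m =
                   M n (Suc m) + (\<beta> m + \<epsilon>) * M n m + \<gamma> m * M n (m - 1)"
    and h: "\<And>n. h (Suc n) = \<gamma> (Suc n) * h n"
    and M0: "\<And>m. m > 2 \<Longrightarrow> M 0 m = 0"
    and M2: "M 0 2 = c * h 2"
    and M1: "M 0 1 = c * (\<beta> 0 + \<beta> 1 + e) * h 1"
    and \<gamma>0: "\<gamma> 0 = 0"
  shows "m > n + 2 \<Longrightarrow> M n m = 0"
    and "M n (n + 2) = c * h (n + 2)"
    and "M n (n + 1) = c * (\<beta> n + \<beta> (n + 1) + e + \<epsilon> * of_nat n) * h (n + 1)"
proof -
  have zero: "m > n + 2 \<Longrightarrow> M n m = 0" for n m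
  proof (induction n arbitrary: m rule: less_induct)
    case (less n)
    show ?case
    proof (cases n)
      case 0
      then show ?thesis using less.prems M0 by simp
    next
      case (Suc k)
      \<comment> \<open>The leftmost entry is the critical one: \<open>m > Suc k + 2\<close> still
        gives \<open>m - 1 > k + 2\<close>.\<close>
      have "M k m = 0" "M k (Suc m) = 0" "M k (m - 1) = 0" "M (k - 1) m = 0"
        using less Suc by auto
      then show ?thesis using rec[of k m] Suc by simp
    qed
  qed
  have two: "M n (n + 2) = c * h (n + 2)" for n
  proof (induction n)
    case 0
    then show ?case using M2 by (simp add: numeral_2_eq_2)
  next
    case (Suc n)
    \<comment> \<open>In column \<open>n + 3\<close> only the two outermost entries survive, so
      \<open>M (n + 1) (n + 3) = \<gamma> (n + 3) * M n (n + 2)\<close>, the same factor by which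
      \<open>h\<close> grows.\<close>
    have "M (n - 1) (n + 3) = 0" "M n (n + 3) = 0" "M n (n + 4) = 0"
      by (auto simp: zero)
    then show ?case
      using rec[of n "n + 3"] h[of "n + 2"] Suc by (simp add: numeral_eq_Suc)
  qed
  have one: "M n (n + 1) = c * (\<beta> n + \<beta> (n + 1) + e + \<epsilon> * of_nat n) * h (n + 1)" for n
  proof (induction n)
    case 0
    then show ?case using M1 by simp
  next
    case (Suc n)
    \<comment> \<open>For \<open>n = 0\<close> the truncated index turns this entry into
      \<open>M 0 2\<close>, which \<open>zero\<close> does not cover; there the factor
      \<open>\<gamma> 0 = 0\<close> removes it.\<close>
    have outer: "\<gamma> n * M (n - 1) (n + 2) = 0" "M n (n + 3) = 0"
      using \<gamma>0 by (cases n) (auto simp: zero)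
    have "M (n + 1) (n + 2) + \<beta> n * M n (n + 2) =
        (\<beta> (n + 2) + \<epsilon>) * M n (n + 2) + \<gamma> (n + 2) * M n (n + 1)"
      using rec[of n "n + 2"] outer by (cases n) (auto simp: numeral_eq_Suc \<gamma>0)
    then have "M (n + 1) (n + 2) = (\<beta> (n + 2) + \<epsilon> - \<beta> n) * (c * h (n + 2))
        + \<gamma> (n + 2) * (c * (\<beta> n + \<beta> (n + 1) + e + \<epsilon> * of_nat n) * h (n + 1))"
      unfolding two Suc by (simp add: algebra_simps)
    moreover have "h (n + 2) = \<gamma> (n + 2) * h (n + 1)"
      using h[of "n + 1"] by simp
    ultimately show ?case by (simp add: algebra_simps)
  qed
  show "m > n + 2 \<Longrightarrow> M n m = 0" by (rule zero)
  show "M n (n + 2) = c * h (n + 2)" by (rule two)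
  show "M n (n + 1) = c * (\<beta> n + \<beta> (n + 1) + e + \<epsilon> * of_nat n) * h (n + 1)" by (rule one)
qed

section \<open>Orthogonal polynomials for an abstract linear functional\<close>

locale orthogonal_recurrence =
  fixes L :: "complex poly \<Rightarrow> complex" and P :: "nat \<Rightarrow> complex poly"
    and \<beta> \<gamma> :: "nat \<Rightarrow> complex"
  assumes L_add: "L (f + g) = L f + L g"
    and L_smult: "L (smult c f) = c * L f"
    and orthogonal: "monic_orthogonal L P"
    and recurrence: "recurrence_coeffs P \<beta> \<gamma>"
begin

definition h :: "nat \<Rightarrow> complex" where
  "h n = L (P n * P n)"

lemma h_nonzero: "h n \<noteq> 0"
  and L_mult: "L (P n * P m) = (if n = m then h n else 0)"
  using orthogonal unfolding monic_orthogonal_def h_def by auto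

lemma gamma_0: "\<gamma> 0 = 0"
  using recurrence by (simp add: recurrence_coeffs_def)

lemmas x_mult = recurrence_coeffs_rec[OF recurrence]

lemma h_Suc: "h (Suc n) = \<gamma> (Suc n) * h n"
  using recurrence_coeffs_formulas(2)[OF L_add L_smult orthogonal recurrence, of "Suc n"]
    h_nonzero[of n]
  by (simp add: h_def power2_eq_square)

lemma P_0: "P 0 = 1"
proof -
  have "degree (P 0) = 0" "lead_coeff (P 0) = 1"
    using orthogonal unfolding monic_orthogonal_def by blast+
  then show ?thesis by (metis monom_0 monom_eq_1 degree_eq_zeroE coeff_pCons_0 one_pCons lead_coeff_pCons(2))
qed

text \<open>Both Pearson polynomials are quadratic. In the basis \<open>P 0\<close>,
  \<open>P 1\<close>, \<open>P 2\<close>, orthogonality reads off the first row and first column of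
  \<open>M\<close>.\<close>

lemma quadratic_expansion:
  "[:q0, q1, q2:] = smult q2 (P 2) + smult (q2 * (\<beta> 0 + \<beta> 1) + q1) (P 1)
     + smult (q2 * (\<gamma> 1 + \<beta> 0 ^ 2) + q1 * \<beta> 0 + q0) (P 0)"
proof -
  have "P 1 = [:0, 1:] * P 0 - smult (\<beta> 0) (P 0)"
    unfolding x_mult by (simp add: gamma_0)
  then have P1: "P 1 = [:- \<beta> 0, 1:]"
    by (simp add: P_0 one_pCons)
  have "P 2 = [:0, 1:] * P 1 - smult (\<beta> 1) (P 1) - smult (\<gamma> 1) (P 0)"
    unfolding x_mult by (simp add: numeral_2_eq_2)
  then show ?thesis
    unfolding P1 P_0 by (simp add: one_pCons algebra_simps power2_eq_square)
qed

lemma L_quadratic: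
  "L ([:q0, q1, q2:] * P m) =
     q2 * L (P 2 * P m) + (q2 * (\<beta> 0 + \<beta> 1) + q1) * L (P 1 * P m)
     + (q2 * (\<gamma> 1 + \<beta> 0 ^ 2) + q1 * \<beta> 0 + q0) * L (P 0 * P m)"
  unfolding quadratic_expansion[of q0 q1 q2]
  by (simp add: distrib_right L_add L_smult)

end

section \<open>The Pearson equation and the banded array\<close>

locale pearson_functional = orthogonal_recurrence +
  fixes a1 a2 b z :: complex
  assumes pearson: "L ([:0, b, 1:] * f) = L ([:z * (a1 * a2), z * (a1 + a2), z:] * (f \<circ>\<^sub>p [:1, 1:]))"
begin

definition M :: "nat \<Rightarrow> nat \<Rightarrow> complex" where
  "M n m = L ([:z * (a1 * a2), z * (a1 + a2), z:] * (P n \<circ>\<^sub>p [:1, 1:]) * P m)"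

text \<open>The factor \<open>x + 1\<close> is attached to either polynomial. On \<open>P n\<close>
  evaluated at \<open>x + 1\<close> it is the shifted variable, so the recurrence applies unchanged;
  on \<open>P m\<close> it is \<open>x\<close> plus one, whence
  \<open>\<beta> m + 1\<close>.\<close>

lemma M_recursion:
  "M (Suc n) m + \<beta> n * M n m + \<gamma> n * M (n - 1) m =
   M n (Suc m) + (\<beta> m + 1) * M n m + \<gamma> m * M n (m - 1)"
proof -
  define \<Phi> where "\<Phi> = [:z * (a1 * a2), z * (a1 + a2), z:]"
  have M: "M k l = L (\<Phi> * (P k \<circ>\<^sub>p [:1, 1:]) * P l)" for k l
    by (simp add: M_def \<Phi>_def)
  have "([:0, 1:] * P n) \<circ>\<^sub>p [:1, 1:] = [:1, 1:] * (P n \<circ>\<^sub>p [:1, 1:])"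
    by (simp only: pcompose_mult pcompose_idR) (simp add: pcompose_pCons)
  then have shift: "[:1, 1:] * (P n \<circ>\<^sub>p [:1, 1:]) = P (Suc n) \<circ>\<^sub>p [:1, 1:]
      + smult (\<beta> n) (P n \<circ>\<^sub>p [:1, 1:]) + smult (\<gamma> n) (P (n - 1) \<circ>\<^sub>p [:1, 1:])"
    unfolding x_mult by (simp add: pcompose_add pcompose_smult)
  have one_x: "[:1, 1:] = [:0, 1:] + (1 :: complex poly)"
    by (simp add: one_pCons)
  have "\<Phi> * ([:1, 1:] * (P n \<circ>\<^sub>p [:1, 1:])) * P m =
      \<Phi> * (P n \<circ>\<^sub>p [:1, 1:]) * ([:1, 1:] * P m)"
    by (simp only: mult_ac)
  also have "[:1, 1:] * P m = P (Suc m) + smult (\<beta> m + 1) (P m) + smult (\<gamma> m) (P (m - 1))"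
    unfolding one_x distrib_right x_mult by (simp add: smult_add_left)
  finally have "L (\<Phi> * (P (Suc n) \<circ>\<^sub>p [:1, 1:] + smult (\<beta> n) (P n \<circ>\<^sub>p [:1, 1:])
        + smult (\<gamma> n) (P (n - 1) \<circ>\<^sub>p [:1, 1:])) * P m) =
      L (\<Phi> * (P n \<circ>\<^sub>p [:1, 1:]) *
        (P (Suc m) + smult (\<beta> m + 1) (P m) + smult (\<gamma> m) (P (m - 1))))"
    unfolding shift by (rule arg_cong)
  then show ?thesis
    by (simp only: M distrib_left distrib_right L_add L_smult mult_smult_left mult_smult_right)
qed

lemma M_0: "M 0 m = L ([:z * (a1 * a2), z * (a1 + a2), z:] * P m)"
  unfolding M_def P_0 by (simp only: pcompose_1 mult_1_right)

lemma M_n_0: "M n 0 = L ([:0, b, 1:] * P n)"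
  unfolding M_def P_0 pearson by (simp only: mult_1_right)

text \<open>Transposing moves the \<open>1\<close> of \<open>M_recursion\<close> to the other side,
  so \<open>\<epsilon>\<close> changes sign. The constants \<open>c\<close> and \<open>e\<close>
  come from the two leading coefficients of the quadratic: \<open>z\<close> and
  \<open>a1 + a2\<close> for the row, \<open>1\<close> and \<open>b\<close> for the column.\<close>

lemmas M_upper = banded_recursion[of M \<beta> \<gamma> 1 h z "a1 + a2", OF M_recursion h_Suc _ _ _ gamma_0]
lemmas M_lower =
  banded_recursion[of "\<lambda>n m. M m n" \<beta> \<gamma> "- 1" h 1 b, OF _ h_Suc _ _ _ gamma_0]

lemma M_Suc_right: "M n (Suc n) = z * (\<beta> n + \<beta> (Suc n) + (a1 + a2) + of_nat n) * h (Suc n)"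
  and M_Suc_Suc_right: "M n (Suc (Suc n)) = z * h (Suc (Suc n))"
proof -
  have 1: "M 0 m = 0" if "m > 2" for m
    using that unfolding M_0 L_quadratic L_mult by simp
  have 2: "M 0 2 = z * h 2" "M 0 1 = z * (\<beta> 0 + \<beta> 1 + (a1 + a2)) * h 1"
    unfolding M_0 L_quadratic L_mult by (simp_all add: algebra_simps)
  show "M n (Suc n) = z * (\<beta> n + \<beta> (Suc n) + (a1 + a2) + of_nat n) * h (Suc n)"
    using M_upper(3)[OF 1 2, of n] by simp
  show "M n (Suc (Suc n)) = z * h (Suc (Suc n))"
    using M_upper(2)[OF 1 2, of n] by simp
qed

lemma M_Suc_left: "M (Suc n) n = (\<beta> n + \<beta> (Suc n) + b - of_nat n) * h (Suc n)"
  and M_Suc_Suc_left: "M (Suc (Suc n)) n = h (Suc (Suc n))"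
proof -
  have 0: "M m (Suc n) + \<beta> n * M m n + \<gamma> n * M m (n - 1) =
      M (Suc m) n + (\<beta> m + - 1) * M m n + \<gamma> m * M (m - 1) n" for n m
    using M_recursion[of m n] by (simp add: algebra_simps)
  have 1: "M m 0 = 0" if "m > 2" for m
    using that unfolding M_n_0 L_quadratic L_mult by simp
  have 2: "M 2 0 = 1 * h 2" "M 1 0 = 1 * (\<beta> 0 + \<beta> 1 + b) * h 1"
    unfolding M_n_0 L_quadratic L_mult by (simp_all add: algebra_simps)
  show "M (Suc n) n = (\<beta> n + \<beta> (Suc n) + b - of_nat n) * h (Suc n)"
    using M_lower(3)[OF 0 1 2, of n] by simp
  show "M (Suc (Suc n)) n = h (Suc (Suc n))"
    using M_lower(2)[OF 0 1 2, of n] by simp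
qed

section \<open>Elimination of the main diagonal\<close>

definition A :: "nat \<Rightarrow> complex" where
  "A n = M n n / h n"

lemma M_diag: "M n n = A n * h n"
  by (simp add: A_def h_nonzero)

definition u :: "nat \<Rightarrow> complex" where
  "u n = \<beta> n + prev \<beta> n - of_nat n + b + 1"

definition v :: "nat \<Rightarrow> complex" where
  "v n = \<beta> n + prev \<beta> n + of_nat n - 1 + a1 + a2"

text \<open>This and \<open>M_u\<close> show where the two sequences come from: up to the factor
  \<open>z\<close>, they are the normalized entries next to the main diagonal.\<close>

lemma M_v: "M n (Suc n) = z * v (Suc n) * h (Suc n)"
  unfolding M_Suc_right by (simp add: v_def prev_def algebra_simps)

lemma M_u: "M (Suc n) n = u (Suc n) * h (Suc n)"
  unfolding M_Suc_left by (simp add: u_def prev_def algebra_simps)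

text \<open>This is \<open>M_recursion\<close> at \<open>(n, n)\<close>: the terms with
  \<open>\<beta> n\<close> cancel, and the shift by \<open>1\<close> leaves a single copy of
  \<open>M n n\<close>.\<close>

lemma A_eq: "A n = (u (Suc n) - z * v (Suc n)) * \<gamma> (Suc n) - (u n - z * v n) * \<gamma> n"
proof -
  have outer: "\<gamma> n * M (n - 1) n = z * v n * \<gamma> n * h n"
    "\<gamma> n * M n (n - 1) = u n * \<gamma> n * h n"
    by (cases n; simp add: gamma_0 M_v M_u)+
  have "h n * A n =
      h n * ((u (Suc n) - z * v (Suc n)) * \<gamma> (Suc n) - (u n - z * v n) * \<gamma> n)"
    using M_recursion[of n n] unfolding outer M_u M_v M_diag h_Suc by (simp add: algebra_simps)
  then show ?thesis using h_nonzero[of n] by simp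
qed

text \<open>This is \<open>M_recursion\<close> at \<open>(n, n + 1)\<close>. By \<open>h_Suc\<close>
  every term is a multiple of \<open>h (Suc n)\<close>, which is then cancelled. The entry
  \<open>(n + 1, n)\<close> gives \<open>A_diff_u\<close> in the same way.\<close>

lemma A_diff_v:
  "A (Suc n) - A n = z * v (Suc n) * (\<beta> (Suc n) - \<beta> n + 1) + z * (\<gamma> (Suc (Suc n)) - \<gamma> n)"
proof -
  have outer: "\<gamma> n * M (n - 1) (Suc n) = z * \<gamma> n * h (Suc n)"
    by (cases n) (simp_all add: gamma_0 M_Suc_Suc_right)
  have "h (Suc n) * (A (Suc n) + \<beta> n * (z * v (Suc n)) + z * \<gamma> n) =
      h (Suc n) * (z * \<gamma> (Suc (Suc n)) + (\<beta> (Suc n) + 1) * (z * v (Suc n)) + A n)"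
    using M_recursion[of n "Suc n"] h_Suc[of n] h_Suc[of "Suc n"]
    unfolding outer M_v M_diag diff_Suc_1 M_Suc_Suc_right by (simp add: algebra_simps)
  then show ?thesis
    unfolding mult_left_cancel[OF h_nonzero] by (simp add: algebra_simps)
qed

lemma A_diff_u:
  "A (Suc n) - A n = u (Suc n) * (\<beta> (Suc n) - \<beta> n - 1) + (\<gamma> (Suc (Suc n)) - \<gamma> n)"
proof -
  have outer: "\<gamma> n * M (Suc n) (n - 1) = \<gamma> n * h (Suc n)"
    by (cases n) (simp_all add: gamma_0 M_Suc_Suc_left)
  have "h (Suc n) * (\<gamma> (Suc (Suc n)) + \<beta> (Suc n) * u (Suc n) + A n) =
      h (Suc n) * (A (Suc n) + (\<beta> n + 1) * u (Suc n) + \<gamma> n)"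
    using M_recursion[of "Suc n" n] h_Suc[of n] h_Suc[of "Suc n"]
    unfolding outer M_u M_diag diff_Suc_1 M_Suc_Suc_left by (simp add: algebra_simps)
  then show ?thesis
    unfolding mult_left_cancel[OF h_nonzero] by (simp add: algebra_simps)
qed

text \<open>The two expressions for \<open>A (Suc k) - A k\<close> are equated.\<close>

lemma laguerre_freud_1:
  assumes "n \<ge> 1"
  shows "(1 - z) * bwd_diff (\<lambda>n. \<gamma> (n + 1) + \<gamma> n) n =
    z * v n * bwd_diff (\<lambda>n. \<beta> n + of_nat n) n - u n * bwd_diff (\<lambda>n. \<beta> n - of_nat n) n"
proof -
  obtain k where "n = Suc k" using assms by (cases n) auto
  then show ?thesis
    using A_diff_v[of k] A_diff_u[of k]
    by (simp add: bwd_diff_def prev_def algebra_simps)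
qed

lemma laguerre_freud_2:
  assumes "n \<ge> 1"
  shows "fwd_diff (bwd_diff (\<lambda>n. (u n - z * v n) * \<gamma> n)) n =
    u n * bwd_diff (\<lambda>n. \<beta> n - of_nat n) n + bwd_diff (\<lambda>n. \<gamma> (n + 1) + \<gamma> n) n"
proof -
  obtain k where k: "n = Suc k" using assms by (cases n) auto
  \<comment> \<open>By \<open>A_eq\<close>, \<open>A\<close> is the forward difference of the
    bracketed sequence, so its increment is the second difference.\<close>
  have "fwd_diff (bwd_diff (\<lambda>n. (u n - z * v n) * \<gamma> n)) n = A (Suc k) - A k"
    by (simp add: k fwd_diff_def bwd_diff_def prev_def A_eq)
  also have "\<dots> = u n * bwd_diff (\<lambda>n. \<beta> n - of_nat n) n + bwd_diff (\<lambda>n. \<gamma> (n + 1) + \<gamma> n) n"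
    unfolding A_diff_u by (simp add: k bwd_diff_def prev_def algebra_simps)
  finally show ?thesis .
qed

text \<open>The entry \<open>M 0 0\<close> is computed in two ways, which is the Pearson equation
  for the constant polynomial \<open>1\<close>.\<close>

lemma gamma_1:
  assumes "z \<noteq> 1"
  shows "\<gamma> 1 = ((a1 + a2 - b) * \<beta> 0 + a1 * a2) / (1 - z) - (\<beta> 0 + a1) * (\<beta> 0 + a2)"
proof -
  have "L ([:z * (a1 * a2), z * (a1 + a2), z:] * P 0) = L ([:0, b, 1:] * P 0)"
    using M_0[of 0] M_n_0[of 0] by simp
  then have "h 0 * (z * (\<gamma> 1 + \<beta> 0 ^ 2) + z * (a1 + a2) * \<beta> 0 + z * (a1 * a2)) =
      h 0 * (\<gamma> 1 + \<beta> 0 ^ 2 + b * \<beta> 0)"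
    unfolding L_quadratic L_mult by (simp add: mult.commute)
  then have "z * (\<gamma> 1 + \<beta> 0 ^ 2) + z * (a1 + a2) * \<beta> 0 + z * (a1 * a2) =
      \<gamma> 1 + \<beta> 0 ^ 2 + b * \<beta> 0"
    using h_nonzero by simp
  \<comment> \<open>Adding \<open>(1 - z) * ((a1 + a2) * \<beta> 0 + a1 * a2)\<close> to both sides
    completes the product.\<close>
  then have "(1 - z) * (\<gamma> 1 + (\<beta> 0 + a1) * (\<beta> 0 + a2)) = (a1 + a2 - b) * \<beta> 0 + a1 * a2"
    by (simp add: algebra_simps power2_eq_square)
  then show ?thesis using assms by (simp add: eq_diff_eq eq_divide_eq mult.commute)
qed

end

section \<open>The Hahn weight: convergence, linearity and Pearson equation\<close>

lemma hahn_weight_pearson: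
  assumes "\<And>k::nat. k \<ge> 1 \<Longrightarrow> b \<noteq> - of_nat k"
  shows "of_nat (Suc x) * (of_nat (Suc x) + b) * hahn_weight a1 a2 b z (Suc x) =
    z * (of_nat x + a1) * (of_nat x + a2) * hahn_weight a1 a2 b z x"
proof -
  have "of_nat (Suc x) + b \<noteq> 0"
    using assms[of "Suc x"] by (auto simp: add_eq_0_iff)
  then have 1: "b + 1 + of_nat x \<noteq> 0" by (simp add: add_ac)
  have 2: "pochhammer (b + 1) x \<noteq> 0"
  proof
    assume "pochhammer (b + 1) x = 0"
    then obtain k where "b + 1 = - of_nat k" by (auto simp: pochhammer_eq_0_iff)
    then have "b = - of_nat k - 1" by (simp add: eq_diff_eq)
    then have "b = - of_nat (Suc k)" by simp
    then show False using assms[of "Suc k"] by simp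
  qed
  have 3: "of_nat (Suc x) \<noteq> (0 :: complex)" by (simp only: of_nat_eq_0_iff)
  have 4: "of_nat (Suc x) + b = b + 1 + of_nat x" by simp
  have "of_nat (Suc x) * (b + 1 + of_nat x) *
      (pochhammer a1 x * (a1 + of_nat x) * (pochhammer a2 x * (a2 + of_nat x)) /
        (pochhammer (b + 1) x * (b + 1 + of_nat x)) *
        (z * z ^ x / (of_nat (Suc x) * fact x))) =
    z * (of_nat x + a1) * (of_nat x + a2) *
      (pochhammer a1 x * pochhammer a2 x / pochhammer (b + 1) x * (z ^ x / fact x))"
    using 1 2 3 by (simp add: divide_simps del: of_nat_Suc) (simp add: mult_ac add_ac)
  then show ?thesis
    unfolding hahn_weight_def pochhammer_Suc power_Suc fact_Suc 4 .
qed

lemma summable_power_hahn_weight: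
  assumes z: "norm z < 1" and b: "\<And>k::nat. k \<ge> 1 \<Longrightarrow> b \<noteq> - of_nat k"
  shows "summable (\<lambda>x. of_nat x ^ k * hahn_weight a1 a2 b z x)"
proof -
  \<comment> \<open>\<open>r x\<close> is the factor from term \<open>x\<close> to term
    \<open>x + 1\<close>, arranged so that the limit \<open>z\<close> is visible. No weight is
    divided by, so vanishing weights cause no trouble.\<close>
  define r where "r = (\<lambda>x. (1 + 1 / of_nat x) ^ k *
    ((1 + (a1 - 1) / of_nat (Suc x)) * (1 + (a2 - 1) / of_nat (Suc x))
      / (1 + b / of_nat (Suc x)) * z))"
  have lim: "(\<lambda>x. c / of_nat (Suc x)) \<longlonglongrightarrow> (0 :: complex)" for c
    by (rule LIMSEQ_Suc[OF lim_const_over_n])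
  have "r \<longlonglongrightarrow> (1 + 0) ^ k * ((1 + 0) * (1 + 0) / (1 + 0) * z)"
    unfolding r_def by (intro tendsto_intros lim lim_const_over_n) auto
  then have "(\<lambda>x. norm (r x)) \<longlonglongrightarrow> norm z" by (simp add: tendsto_norm)
  moreover obtain c where c: "norm z < c" "c < 1" using z dense by blast
  ultimately have "eventually (\<lambda>x. norm (r x) < c) sequentially"
    by (intro order_tendstoD)
  then obtain N where N: "\<And>x. x \<ge> N \<Longrightarrow> norm (r x) < c"
    by (auto simp: eventually_sequentially)
  show ?thesis
  \<comment> \<open>Starting at \<open>Suc N\<close> ensures \<open>x > 0\<close>, so that
    \<open>1 / of_nat x\<close> in \<open>r\<close> is a genuine quotient.\<close>
  proof (rule summable_ratio_test[OF c(2), of "Suc N"])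
    fix x assume x: "Suc N \<le> x"
    define s :: complex where "s = of_nat (Suc x)"
    have s: "s \<noteq> 0" "of_nat x = s - 1" "s - 1 \<noteq> 0" "of_nat (Suc x) = s"
      using x unfolding s_def by (simp_all only: of_nat_eq_0_iff) auto
    have sb: "s + b \<noteq> 0"
      using b[of "Suc x"] unfolding s_def by (auto simp: add_eq_0_iff)
    have r: "r x * (s - 1) ^ k = s ^ k * ((s - 1 + a1) * (s - 1 + a2) * z / (s * (s + b)))"
    proof -
      have "1 + 1 / (s - 1) = s / (s - 1)" "1 + (a1 - 1) / s = (s - 1 + a1) / s"
        "1 + (a2 - 1) / s = (s - 1 + a2) / s" "1 + b / s = (s + b) / s"
        using s by (simp_all add: field_simps)
      then show ?thesis
        unfolding r_def s(2,4) using s sb by (simp add: power_divide)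
    qed
    have "s * (s + b) * hahn_weight a1 a2 b z (Suc x) =
        z * (s - 1 + a1) * (s - 1 + a2) * hahn_weight a1 a2 b z x"
      using hahn_weight_pearson[OF b, of x a1 a2 z] unfolding s(2,4) .
    then have w: "hahn_weight a1 a2 b z (Suc x) =
        (s - 1 + a1) * (s - 1 + a2) * z / (s * (s + b)) * hahn_weight a1 a2 b z x"
      using s(1) sb by (simp add: eq_divide_eq mult_ac)
    have "of_nat (Suc x) ^ k * hahn_weight a1 a2 b z (Suc x) =
        r x * (of_nat x ^ k * hahn_weight a1 a2 b z x)"
      unfolding s(2,4) w mult.assoc[symmetric] r by simp
    then have "norm (of_nat (Suc x) ^ k * hahn_weight a1 a2 b z (Suc x)) =
        norm (r x) * norm (of_nat x ^ k * hahn_weight a1 a2 b z x)"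
      by (simp only: norm_mult)
    also have "\<dots> \<le> c * norm (of_nat x ^ k * hahn_weight a1 a2 b z x)"
      using N[of x] x by (intro mult_right_mono) auto
    finally show "norm (of_nat (Suc x) ^ k * hahn_weight a1 a2 b z (Suc x)) \<le>
      c * norm (of_nat x ^ k * hahn_weight a1 a2 b z x)" .
  qed
qed

lemma summable_poly_hahn_weight:
  assumes z: "norm z < 1" and b: "\<And>k::nat. k \<ge> 1 \<Longrightarrow> b \<noteq> - of_nat k"
  shows "summable (\<lambda>x. poly f (of_nat x) * hahn_weight a1 a2 b z x)"
  unfolding poly_altdef sum_distrib_right mult.assoc
  by (intro summable_sum summable_mult summable_power_hahn_weight[OF z b]) auto

lemma hahn_functional_add:
  assumes z: "norm z < 1" and b: "\<And>k::nat. k \<ge> 1 \<Longrightarrow> b \<noteq> - of_nat k"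
  shows "hahn_functional a1 a2 b z (f + g) = hahn_functional a1 a2 b z f + hahn_functional a1 a2 b z g"
  unfolding hahn_functional_def
  by (simp add: distrib_right suminf_add[OF summable_poly_hahn_weight[OF z b] summable_poly_hahn_weight[OF z b]])

lemma hahn_functional_smult:
  assumes z: "norm z < 1" and b: "\<And>k::nat. k \<ge> 1 \<Longrightarrow> b \<noteq> - of_nat k"
  shows "hahn_functional a1 a2 b z (smult c f) = c * hahn_functional a1 a2 b z f"
  unfolding hahn_functional_def
  by (simp add: mult.assoc suminf_mult[OF summable_poly_hahn_weight[OF z b]])

lemma hahn_functional_pearson:
  assumes z: "norm z < 1" and b: "\<And>k::nat. k \<ge> 1 \<Longrightarrow> b \<noteq> - of_nat k"
  shows "hahn_functional a1 a2 b z ([:0, b, 1:] * f) =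
    hahn_functional a1 a2 b z ([:z * (a1 * a2), z * (a1 + a2), z:] * (f \<circ>\<^sub>p [:1, 1:]))"
proof -
  let ?g = "\<lambda>x. poly ([:0, b, 1:] * f) (of_nat x) * hahn_weight a1 a2 b z x"
  have "?g (Suc x) = poly ([:z * (a1 * a2), z * (a1 + a2), z:] * (f \<circ>\<^sub>p [:1, 1:])) (of_nat x)
      * hahn_weight a1 a2 b z x" for x
  proof -
    have "?g (Suc x) = of_nat (Suc x) * (of_nat (Suc x) + b) * hahn_weight a1 a2 b z (Suc x)
        * poly f (of_nat (Suc x))"
      by (simp add: algebra_simps)
    also have "\<dots> = z * (of_nat x + a1) * (of_nat x + a2) * hahn_weight a1 a2 b z x
        * poly f (of_nat (Suc x))"
      using hahn_weight_pearson[OF b, of x a1 a2 z] by (simp only:)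
    finally show ?thesis by (simp add: poly_pcompose algebra_simps)
  qed
  \<comment> \<open>The term at \<open>x = 0\<close> vanishes because \<open>[:0, b, 1:]\<close> has
    the factor \<open>x\<close>.\<close>
  moreover have "suminf ?g = (\<Sum>x. ?g (Suc x))"
    using suminf_split_head[OF summable_poly_hahn_weight[OF z b, of "[:0, b, 1:] * f"]] by simp
  ultimately show ?thesis
    unfolding hahn_functional_def by simp
qed

section \<open>The first two moments\<close>

lemma hahn_moment_0: "hahn_functional a1 a2 b z (monom 1 0) = hyp2F1 a1 a2 (b + 1) z"
  by (simp add: hahn_functional_def hyp2F1_series hahn_weight_def)

text \<open>The factor \<open>x\<close> removes the first term and cancels against
  \<open>fact x\<close>. Splitting the first factor off each Pochhammer symbol then leaves a Hahn
  weight with all three parameters raised by one.\<close>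

lemma hahn_moment_1:
  assumes z: "norm z < 1" and b: "\<And>k::nat. k \<ge> 1 \<Longrightarrow> b \<noteq> - of_nat k"
  shows "hahn_functional a1 a2 b z (monom 1 1) =
    z * (a1 * a2 / (b + 1)) * hyp2F1 (a1 + 1) (a2 + 1) (b + 2) z"
proof -
  \<comment> \<open>The shifted weight must satisfy the same parameter condition to be
    summable.\<close>
  have b': "b + 1 \<noteq> - of_nat k" if "k \<ge> 1" for k :: nat
  proof
    assume "b + 1 = - of_nat k"
    then have "b = - of_nat k - 1" by (simp add: eq_diff_eq)
    then have "b = - of_nat (Suc k)" by simp
    then show False using b[of "Suc k"] by simp
  qed
  let ?g = "\<lambda>x. poly (monom 1 1) (of_nat x) * hahn_weight a1 a2 b z x"
  have g: "?g (Suc x) =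
      z * (a1 * a2 / (b + 1)) * hahn_weight (a1 + 1) (a2 + 1) (b + 1) z x" for x
  proof -
    have "of_nat (Suc x) \<noteq> (0 :: complex)" by (simp only: of_nat_eq_0_iff)
    then show ?thesis
      unfolding hahn_weight_def pochhammer_rec power_Suc fact_Suc
      by (simp add: poly_monom del: of_nat_Suc)
  qed
  have "hahn_functional a1 a2 b z (monom 1 1) = (\<Sum>x. ?g (Suc x))"
    using suminf_split_head[OF summable_poly_hahn_weight[OF z b, of "monom 1 1"]]
    by (simp add: hahn_functional_def poly_monom)
  also have "\<dots> = z * (a1 * a2 / (b + 1)) * (\<Sum>x. hahn_weight (a1 + 1) (a2 + 1) (b + 1) z x)"
    unfolding g using summable_power_hahn_weight[OF z b', of 0]
    by (intro suminf_mult) simp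
  also have "(\<Sum>x. hahn_weight (a1 + 1) (a2 + 1) (b + 1) z x) =
      hyp2F1 (a1 + 1) (a2 + 1) (b + 2) z"
    unfolding hyp2F1_series hahn_weight_def by (simp add: add.assoc)
  finally show ?thesis .
qed

theorem theorem4:
  fixes a1 a2 b z :: complex
    and P :: "nat \<Rightarrow> complex poly"
    and \<beta> \<gamma> \<mu> u v :: "nat \<Rightarrow> complex"
  assumes z: "norm z < 1"
    and b: "\<And>k::nat. k \<ge> 1 \<Longrightarrow> b \<noteq> - of_nat k"
    and P: "monic_orthogonal (hahn_functional a1 a2 b z) P"
    and rec: "recurrence_coeffs P \<beta> \<gamma>"
  defines "\<mu> \<equiv> \<lambda>k. hahn_functional a1 a2 b z (monom 1 k)"
    and "u \<equiv> \<lambda>n. \<beta> n + prev \<beta> n - of_nat n + b + 1"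
    and "v \<equiv> \<lambda>n. \<beta> n + prev \<beta> n + of_nat n - 1 + a1 + a2"
  shows "(\<forall>n\<ge>1.
        (1 - z) * bwd_diff (\<lambda>n. \<gamma> (n + 1) + \<gamma> n) n =
          z * v n * bwd_diff (\<lambda>n. \<beta> n + of_nat n) n - u n * bwd_diff (\<lambda>n. \<beta> n - of_nat n) n
      \<and> fwd_diff (bwd_diff (\<lambda>n. (u n - z * v n) * \<gamma> n)) n =
          u n * bwd_diff (\<lambda>n. \<beta> n - of_nat n) n + bwd_diff (\<lambda>n. \<gamma> (n + 1) + \<gamma> n) n)
    \<and> \<beta> 0 = \<mu> 1 / \<mu> 0
    \<and> \<gamma> 1 = ((a1 + a2 - b) * \<beta> 0 + a1 * a2) / (1 - z) - (\<beta> 0 + a1) * (\<beta> 0 + a2)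
    \<and> \<mu> 0 = hyp2F1 a1 a2 (b + 1) z
    \<and> \<mu> 1 = z * (a1 * a2 / (b + 1)) * hyp2F1 (a1 + 1) (a2 + 1) (b + 2) z"
proof -
  interpret pf: pearson_functional "hahn_functional a1 a2 b z" P \<beta> \<gamma> a1 a2 b z
    by unfold_locales
      (rule hahn_functional_add[OF z b] hahn_functional_smult[OF z b]
        hahn_functional_pearson[OF z b] P rec; assumption)+
  have uv: "u = pf.u" "v = pf.v"
    by (simp_all add: u_def v_def pf.u_def pf.v_def fun_eq_iff)
  have "z \<noteq> 1" using z by auto
  moreover have "\<beta> 0 = \<mu> 1 / \<mu> 0"
    using recurrence_coeffs_formulas(1)[OF pf.L_add pf.L_smult P rec, of 0]
    by (simp add: \<mu>_def pf.P_0 monom_altdef)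
  ultimately show ?thesis
    unfolding uv
    using pf.laguerre_freud_1 pf.laguerre_freud_2 pf.gamma_1 hahn_moment_0 hahn_moment_1[OF z b]
    by (auto simp: \<mu>_def)
qed

end
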